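(* Let $d>1$, $p\ge 0$ be integers, let $\mathcal{A}=\{\boldsymbol\alpha_1,\ldots,\boldsymbol\alpha_{N}\}$, $N=|\mathcal{A}|=\binom{d+p}{p}$, be the set of multi-indices $\boldsymbol\alpha=(\alpha^{(1)},\ldots,\alpha^{(d)})\in\mathbb{N}_0^d$ with $\sum_{s=1}^d\alpha^{(s)}\le p$, in an arbitrary fixed order, and let $n\ge N$. For $X\in\mathbb{R}^{n\times d}$ with rows $\mathbf{x}_1^T,\ldots,\mathbf{x}_n^T$, where $\mathbf{x}_m=(x_m^{(1)},\ldots,x_m^{(d)})^T$, let $A(X)\in\mathbb{R}^{n\times N}$ be the matrix with entries $$A_{mj}(X)=\prod_{s=1}^d\psi_{\alpha_j^{(s)}}\bigl(x_m^{(s)}\bigr),$$ let $B(X)=A(X)^TA(X)$, and, wherever $\det B(X)\ne 0$, let $\widehat W(X)=-\log\det B(X)$. Then for every $X\in\mathbb{R}^{n\times d}$ with $\det B(X)\neq 0$ and all $k\in\{1,\ldots,n\}$, $l\in\{1,\ldots,d\}$, the element $G_{kl}=\partial\widehat W(X)/\partial x_k^{(l)}$ of the gradient matrix $G\in\mathbb{R}^{n\times d}$ equals $$G_{kl}=-\sum_{i,j=1}^{N}\bigl(B^{-1}(X)\bigr)_{ji}\left[\frac{\partial\psi_{\alpha_i^{(l)}}(x_k^{(l)})}{\partial x_k^{(l)}}\,\psi_{\alpha_j^{(l)}}(x_k^{(l)})+\psi_{\alpha_i^{(l)}}(x_k^{(l)})\,\frac{\partial\psi_{\alpha_j^{(l)}}(x_k^{(l)})}{\partial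 x_k^{(l)}}\right]\prod_{\substack{q=1\\ q\ne l}}^{d}\psi_{\alpha_i^{(q)}}(x_k^{(q)})\,\psi_{\alpha_j^{(q)}}(x_k^{(q)}).$$
   Context: The polynomials $\psi_0,\psi_1,\psi_2,\ldots$ form a fixed family of real univariate orthogonal polynomials (orthogonal with respect to some inner product), where $\psi_a$ has degree $a$. Here $\mathbb{N}_0=\mathbb{N}\cup\{0\}$, and $\alpha_j^{(s)}$ denotes the $s$-th component of the multi-index $\boldsymbol\alpha_j$. The matrix $X$ (experimental design) collects $n$ points of $\mathbb{R}^d$ as its rows, and $A(X)$ is the associated Vandermonde-like model matrix. The matrix $B(X)$ is symmetric and non-negative definite. The notation $\partial\psi_a(x_k^{(l)})/\partial x_k^{(l)}$ means $\psi_a'(x_k^{(l)})$. *)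

theory Defs
  imports "HOL-Analysis.Analysis" "HOL-Computational_Algebra.Polynomial"
begin

definition is_poly_inner_product :: "(real poly \<Rightarrow> real poly \<Rightarrow> real) \<Rightarrow> bool" where
  "is_poly_inner_product ip \<longleftrightarrow>
     (\<forall>f g. ip f g = ip g f) \<and>
     (\<forall>f g h. ip (f + g) h = ip f h + ip g h) \<and>
     (\<forall>c f g. ip (smult c f) g = c * ip f g) \<and>
     (\<forall>f. f \<noteq> 0 \<longrightarrow> ip f f > 0)"

(* The clause "psi a \<noteq> 0" only matters for a = 0, because degree 0 = 0 for the zero polynomial. *)
definition orthogonal_poly_family :: "(nat \<Rightarrow> real poly) \<Rightarrow> bool" where
  "orthogonal_poly_family \<psi> \<longleftrightarrow>
     (\<forall>a. \<psi> a \<noteq> 0 \<and> degree (\<psi> a) = a) \<and>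
     (\<exists>ip. is_poly_inner_product ip \<and> (\<forall>a b. a \<noteq> b \<longrightarrow> ip (\<psi> a) (\<psi> b) = 0))"

definition multi_indices :: "nat \<Rightarrow> (nat ^ 'd) set" where
  "multi_indices p = {a. (\<Sum>s\<in>UNIV. a $ s) \<le> p}"

lemma card_multi_indices:
  "card (multi_indices p :: (nat ^ 'd) set) = (CARD('d) + p) choose p"
proof -
  let ?d = "CARD('d)"
  obtain h :: "nat \<Rightarrow> 'd" where h: "bij_betw h {0..<?d} UNIV"
    using ex_bij_betw_nat_finite[of "UNIV :: 'd set"] by auto
  define F where "F = (\<lambda>a :: nat ^ 'd. (p - (\<Sum>s\<in>UNIV. a $ s)) # map (\<lambda>i. a $ h i) [0..<?d])"
  have sum_h: "sum_list (map (\<lambda>i. g (h i)) [0..<?d]) = (\<Sum>s\<in>UNIV. g s)" for g :: "'d \<Rightarrow> nat"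
    using sum.reindex_bij_betw[OF h, of g] by (simp add: sum_list_distinct_conv_sum_set)
  have "bij_betw F (multi_indices p) {l. length l = Suc ?d \<and> sum_list l = p}"
    unfolding bij_betw_def
  proof (intro conjI equalityI subsetI)
    show "inj_on F (multi_indices p)"
    proof (rule inj_onI)
      fix a b assume "F a = F b"
      then have eq: "\<And>i. i < ?d \<Longrightarrow> a $ h i = b $ h i" by (auto simp: F_def)
      show "a = b"
      proof (unfold vec_eq_iff, rule allI)
        fix s
        obtain i where "i < ?d" "h i = s" using h unfolding bij_betw_def by (metis UNIV_I atLeastLessThan_iff imageE)
        then show "a $ s = b $ s" using eq by auto
      qed
    qed
  next
    fix l assume "l \<in> F ` multi_indices p"
    then show "l \<in> {l. length l = Suc ?d \<and> sum_list l = p}"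
      using sum_h by (auto simp: F_def multi_indices_def)
  next
    fix l assume "l \<in> {l. length l = Suc ?d \<and> sum_list l = p}"
    then obtain x r where l: "l = x # r" "length r = ?d" "x + sum_list r = p"
      by (cases l) auto
    define a :: "nat ^ 'd" where "a = (\<chi> s. r ! the_inv_into {0..<?d} h s)"
    have inj: "inj_on h {0..<?d}" using h by (simp add: bij_betw_def)
    have r: "map (\<lambda>i. a $ h i) [0..<?d] = r"
      by (rule nth_equalityI) (auto simp: a_def l the_inv_into_f_f[OF inj])
    have "(\<Sum>s\<in>UNIV. a $ s) = sum_list r" using sum_h[of "\<lambda>s. a $ s"] r by simp
    then have "a \<in> multi_indices p" "F a = l"
      using l r by (auto simp: F_def multi_indices_def)
    then show "l \<in> F ` multi_indices p" by blast
  qed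
  then have "card (multi_indices p :: (nat ^ 'd) set) = card {l. length l = Suc ?d \<and> sum_list l = p}"
    by (rule bij_betw_same_card)
  also have "\<dots> = (?d + p) choose p"
    using card_length_sum_list[of "Suc ?d" p] by (simp add: add.commute)
  finally show ?thesis .
qed

definition model_matrix ::
    "(nat \<Rightarrow> real poly) \<Rightarrow> ('N \<Rightarrow> nat ^ 'd) \<Rightarrow> real ^ 'd ^ 'n \<Rightarrow> real ^ 'N ^ 'n" where
  "model_matrix \<psi> \<alpha> X = (\<chi> m j. \<Prod>s\<in>UNIV. poly (\<psi> (\<alpha> j $ s)) (X $ m $ s))"

definition information_matrix ::
    "(nat \<Rightarrow> real poly) \<Rightarrow> ('N \<Rightarrow> nat ^ 'd) \<Rightarrow> real ^ 'd ^ 'n \<Rightarrow> real ^ 'N ^ 'N" where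
  "information_matrix \<psi> \<alpha> X = transpose (model_matrix \<psi> \<alpha> X) ** model_matrix \<psi> \<alpha> X"

(* Mathematically only defined where the determinant is nonzero; that set is open, so the values
   at the remaining points do not affect partial derivatives taken inside it. *)
definition W_hat ::
    "(nat \<Rightarrow> real poly) \<Rightarrow> ('N::finite \<Rightarrow> nat ^ 'd) \<Rightarrow> real ^ 'd ^ 'n \<Rightarrow> real" where
  "W_hat \<psi> \<alpha> X = - ln (det (information_matrix \<psi> \<alpha> X))"

definition set_entry :: "'a ^ 'd ^ 'n \<Rightarrow> 'n \<Rightarrow> 'd \<Rightarrow> 'a \<Rightarrow> 'a ^ 'd ^ 'n" where
  "set_entry X k l t = (\<chi> m s. if m = k \<and> s = l then t else X $ m $ s)"

(* deriv is unspecified where the derivative does not exist, so statements about gradient_matrix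
   should come with the differentiability of the functions below. *)
definition gradient_matrix :: "(real ^ 'd ^ 'n \<Rightarrow> real) \<Rightarrow> real ^ 'd ^ 'n \<Rightarrow> real ^ 'd ^ 'n" where
  "gradient_matrix f X = (\<chi> k l. deriv (\<lambda>t. f (set_entry X k l t)) (X $ k $ l))"

end

theory Submission
  imports Defs
begin

text \<open>
  The formula is Jacobi's formula for the logarithmic derivative of a determinant,
  \<open>(log det B)' = trace (B\<inverse> B')\<close> (lemma \<open>has_real_derivative_ln_det\<close>), applied to the curve
  of Gram matrices \<open>B = A\<^sup>T A\<close> that arises when the single coordinate \<open>(k, l)\<close> of the design moves.

  Jacobi's formula is reduced to the identity matrix. Writing \<open>B(t) = B(t\<^sub>0) C(t)\<close> with
  \<open>C(t) = B(t\<^sub>0)\<inverse> B(t)\<close>, multiplicativity of the determinant leaves the derivative of \<open>det C\<close> at a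
  point where \<open>C\<close> is the identity. There the Leibniz expansion loses every permutation but the
  identity, because any other permutation moves at least two indices and the product rule can
  differentiate only one of the two vanishing factors; what remains is the trace of \<open>C'\<close>.

  For the derivative of \<open>B\<close>, note that \<open>B\<^sub>i\<^sub>j = (\<Sum>m. A\<^sub>m\<^sub>i A\<^sub>m\<^sub>j)\<close> and that only the row \<open>m = k\<close> of \<open>A\<close> sees
  the moving coordinate, through the one factor \<open>s = l\<close> of each product \<open>A\<^sub>k\<^sub>j\<close>. Hence \<open>B'\<^sub>i\<^sub>j\<close> is the
  bracket of the theorem times the product over the coordinates \<open>q \<noteq> l\<close>
  (lemma \<open>has_derivative_information_matrix_entry\<close>), and expanding the trace gives the double sum.
\<close>

text \<open>If the product of all entries but one along a permutation is nonzero in the identity matrix,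
  the permutation fixes all indices but one, hence all of them.\<close>

lemma prod_mat_1_remove_permutes:
  fixes p :: "'n::finite \<Rightarrow> 'n"
  assumes p: "p permutes UNIV"
  shows "(\<Prod>j\<in>UNIV - {i}. (mat 1 :: real^'n^'n) $ j $ p j) = (if p = id then 1 else 0)"
proof (cases "p = id")
  case False
  have "\<exists>j. j \<noteq> i \<and> p j \<noteq> j"
  proof (rule ccontr)
    assume "\<not> ?thesis"
    then have fixed: "p j = j" if "j \<noteq> i" for j
      using that by blast
    then have "p i = i"
      using permutes_inj[OF p] by (metis injD)
    with fixed have "p = id"
      by (metis eq_id_iff)
    with False show False ..
  qed
  then show ?thesis
    using False by (force simp: mat_def)
qed (simp add: mat_def)

lemma has_derivative_det_at_identity:
  fixes C :: "real \<Rightarrow> real^'n^'n"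
  assumes deriv: "\<And>i j. ((\<lambda>t. C t $ i $ j) has_real_derivative C' $ i $ j) (at x)"
    and identity: "C x = mat 1"
  shows "((\<lambda>t. det (C t)) has_real_derivative trace C') (at x)"
proof -
  let ?P = "{p. p permutes (UNIV :: 'n set)}"
  have "((\<lambda>t. det (C t)) has_real_derivative
      (\<Sum>p\<in>?P. of_int (sign p) *
        (\<Sum>i\<in>UNIV. C' $ i $ p i * (\<Prod>j\<in>UNIV - {i}. C x $ j $ p j)))) (at x)"
    unfolding det_def
    by (intro DERIV_sum DERIV_cmult has_field_derivative_prod deriv)
  also have "(\<Sum>p\<in>?P. of_int (sign p) *
        (\<Sum>i\<in>UNIV. C' $ i $ p i * (\<Prod>j\<in>UNIV - {i}. C x $ j $ p j))) =
      (\<Sum>p\<in>?P. if p = id then trace C' else 0)"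
    by (intro sum.cong refl)
      (auto simp: identity prod_mat_1_remove_permutes trace_def sign_id)
  also have "\<dots> = trace C'"
    by (simp add: permutes_id)
  finally show ?thesis .
qed

lemma matrix_inv_det_nz:
  fixes A :: "real^'n^'n"
  assumes "det A \<noteq> 0"
  shows "A ** matrix_inv A = mat 1" and "matrix_inv A ** A = mat 1"
proof -
  have "\<exists>A'. A ** A' = mat 1 \<and> A' ** A = mat 1"
    using assms invertible_det_nz[of A] unfolding invertible_def by blast
  then have "A ** matrix_inv A = mat 1 \<and> matrix_inv A ** A = mat 1"
    unfolding matrix_inv_def by (rule someI_ex)
  then show "A ** matrix_inv A = mat 1" and "matrix_inv A ** A = mat 1"
    by auto
qed

text \<open>Factoring out the value \<open>B x\<close> moves the differentiation to a curve through the identity.\<close>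

lemma has_derivative_det:
  fixes B :: "real \<Rightarrow> real^'n^'n"
  assumes deriv: "\<And>i j. ((\<lambda>t. B t $ i $ j) has_real_derivative B' $ i $ j) (at x)"
    and nz: "det (B x) \<noteq> 0"
  shows "((\<lambda>t. det (B t)) has_real_derivative
    det (B x) * trace (matrix_inv (B x) ** B')) (at x)"
proof -
  let ?C = "\<lambda>t. matrix_inv (B x) ** B t"
  have "((\<lambda>t. ?C t $ i $ j) has_real_derivative (matrix_inv (B x) ** B') $ i $ j) (at x)" for i j
    unfolding matrix_matrix_mult_def vec_lambda_beta
    by (intro DERIV_sum DERIV_cmult deriv)
  then have "((\<lambda>t. det (?C t)) has_real_derivative trace (matrix_inv (B x) ** B')) (at x)"
    by (rule has_derivative_det_at_identity) (rule matrix_inv_det_nz[OF nz])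
  then have "((\<lambda>t. det (B x) * det (?C t)) has_real_derivative
      det (B x) * trace (matrix_inv (B x) ** B')) (at x)"
    by (rule DERIV_cmult)
  moreover have "det (B x) * det (?C t) = det (B t)" for t
    by (simp add: matrix_mul_assoc matrix_inv_det_nz[OF nz] flip: det_mul)
  ultimately show ?thesis
    by simp
qed

text \<open>The real logarithm is extended to negative arguments by \<open>ln (- x) = ln x\<close>, so it is a
  primitive of \<open>1 / x\<close> on both half-lines, just as \<open>log \<bar>x\<bar>\<close> is.\<close>

lemma has_derivative_ln_nonzero:
  fixes x :: real
  assumes "x \<noteq> 0"
  shows "(ln has_real_derivative 1 / x) (at x)"
proof (cases "x > 0")
  case True
  then show ?thesis
    by (rule DERIV_ln_divide)
next
  case False
  then have "((\<lambda>y. ln (- y)) has_real_derivative 1 / x) (at x)"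
    using assms by (auto intro!: derivative_eq_intros)
  then show ?thesis
    by (simp add: ln_minus)
qed

lemma has_real_derivative_ln_det:
  fixes B :: "real \<Rightarrow> real^'n^'n"
  assumes "\<And>i j. ((\<lambda>t. B t $ i $ j) has_real_derivative B' $ i $ j) (at x)"
    and nz: "det (B x) \<noteq> 0"
  shows "((\<lambda>t. ln (det (B t))) has_real_derivative trace (matrix_inv (B x) ** B')) (at x)"
  using DERIV_chain2[OF has_derivative_ln_nonzero[OF nz] has_derivative_det[OF assms]] nz
  by simp

lemma set_entry_same: "set_entry X k l (X $ k $ l) = X"
  by (simp add: set_entry_def vec_eq_iff)

lemma model_matrix_set_entry:
  "model_matrix \<psi> \<alpha> (set_entry X k l t) $ m $ j =
    (if m = k
     then poly (\<psi> (\<alpha> j $ l)) t * (\<Prod>q\<in>UNIV - {l}. poly (\<psi> (\<alpha> j $ q)) (X $ k $ q))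
     else model_matrix \<psi> \<alpha> X $ m $ j)"
proof -
  have "(\<Prod>s\<in>UNIV. poly (\<psi> (\<alpha> j $ s)) (set_entry X k l t $ k $ s)) =
      poly (\<psi> (\<alpha> j $ l)) t * (\<Prod>q\<in>UNIV - {l}. poly (\<psi> (\<alpha> j $ q)) (X $ k $ q))"
    by (subst prod.remove[of _ l]) (auto simp: set_entry_def)
  then show ?thesis
    by (auto simp: model_matrix_def set_entry_def)
qed

lemma information_matrix_set_entry:
  "information_matrix \<psi> \<alpha> (set_entry X k l t) $ i $ j =
    poly (\<psi> (\<alpha> i $ l)) t * poly (\<psi> (\<alpha> j $ l)) t *
      (\<Prod>q\<in>UNIV - {l}. poly (\<psi> (\<alpha> i $ q)) (X $ k $ q) * poly (\<psi> (\<alpha> j $ q)) (X $ k $ q)) +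
    (\<Sum>m\<in>UNIV - {k}. model_matrix \<psi> \<alpha> X $ m $ i * model_matrix \<psi> \<alpha> X $ m $ j)"
  unfolding information_matrix_def matrix_matrix_mult_def transpose_def vec_lambda_beta
  by (subst sum.remove[of _ k]) (simp_all add: model_matrix_set_entry prod.distrib)

lemma has_derivative_information_matrix_entry:
  "((\<lambda>t. information_matrix \<psi> \<alpha> (set_entry X k l t) $ i $ j) has_real_derivative
    (deriv (poly (\<psi> (\<alpha> i $ l))) x * poly (\<psi> (\<alpha> j $ l)) x +
     poly (\<psi> (\<alpha> i $ l)) x * deriv (poly (\<psi> (\<alpha> j $ l))) x) *
    (\<Prod>q\<in>UNIV - {l}. poly (\<psi> (\<alpha> i $ q)) (X $ k $ q) * poly (\<psi> (\<alpha> j $ q)) (X $ k $ q))) (at x)"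
proof -
  have "deriv (poly f) x = poly (pderiv f) x" for f :: "real poly"
    using poly_DERIV[of f x] by (metis DERIV_imp_deriv)
  then show ?thesis
    unfolding information_matrix_set_entry
    by (auto intro!: derivative_eq_intros simp: algebra_simps)
qed

theorem mainTheorem2:
  fixes \<psi> :: "nat \<Rightarrow> real poly"
    and p :: nat
    and \<alpha> :: "'N::finite \<Rightarrow> nat ^ 'd::finite"
    and X :: "real ^ 'd ^ 'n::finite"
    and k :: 'n and l :: 'd
  assumes "orthogonal_poly_family \<psi>"
    and "CARD('d) > 1"
    and "bij_betw \<alpha> UNIV (multi_indices p)"
    and "CARD('n) \<ge> CARD('N)"
    and "det (information_matrix \<psi> \<alpha> X) \<noteq> 0"
  shows "(\<lambda>t. W_hat \<psi> \<alpha> (set_entry X k l t)) differentiable at (X $ k $ l) \<and>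
    gradient_matrix (W_hat \<psi> \<alpha>) X $ k $ l =
      - (\<Sum>i\<in>UNIV. \<Sum>j\<in>UNIV. matrix_inv (information_matrix \<psi> \<alpha> X) $ j $ i *
          (deriv (poly (\<psi> (\<alpha> i $ l))) (X $ k $ l) * poly (\<psi> (\<alpha> j $ l)) (X $ k $ l) +
           poly (\<psi> (\<alpha> i $ l)) (X $ k $ l) * deriv (poly (\<psi> (\<alpha> j $ l))) (X $ k $ l)) *
          (\<Prod>q\<in>UNIV - {l}. poly (\<psi> (\<alpha> i $ q)) (X $ k $ q) * poly (\<psi> (\<alpha> j $ q)) (X $ k $ q)))"
proof -
  let ?x = "X $ k $ l"
  let ?B = "\<lambda>t. information_matrix \<psi> \<alpha> (set_entry X k l t)"
  define B' :: "real ^ 'N ^ 'N" where "B' = (\<chi> i j.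
    (deriv (poly (\<psi> (\<alpha> i $ l))) ?x * poly (\<psi> (\<alpha> j $ l)) ?x +
     poly (\<psi> (\<alpha> i $ l)) ?x * deriv (poly (\<psi> (\<alpha> j $ l))) ?x) *
    (\<Prod>q\<in>UNIV - {l}. poly (\<psi> (\<alpha> i $ q)) (X $ k $ q) * poly (\<psi> (\<alpha> j $ q)) (X $ k $ q)))"
  have "((\<lambda>t. ?B t $ i $ j) has_real_derivative B' $ i $ j) (at ?x)" for i j
    unfolding B'_def vec_lambda_beta by (rule has_derivative_information_matrix_entry)
  then have "((\<lambda>t. ln (det (?B t))) has_real_derivative
      trace (matrix_inv (?B ?x) ** B')) (at ?x)"
    by (rule has_real_derivative_ln_det) (simp add: set_entry_same assms(5))
  then have W: "((\<lambda>t. W_hat \<psi> \<alpha> (set_entry X k l t)) has_real_derivative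
      - trace (matrix_inv (information_matrix \<psi> \<alpha> X) ** B')) (at ?x)"
    unfolding W_hat_def set_entry_same by (rule DERIV_minus)
  have "trace (matrix_inv (information_matrix \<psi> \<alpha> X) ** B') =
      (\<Sum>i\<in>UNIV. \<Sum>j\<in>UNIV. matrix_inv (information_matrix \<psi> \<alpha> X) $ j $ i * B' $ i $ j)"
    unfolding trace_def matrix_matrix_mult_def vec_lambda_beta by (rule sum.swap)
  then have "gradient_matrix (W_hat \<psi> \<alpha>) X $ k $ l =
      - (\<Sum>i\<in>UNIV. \<Sum>j\<in>UNIV. matrix_inv (information_matrix \<psi> \<alpha> X) $ j $ i * B' $ i $ j)"
    using DERIV_imp_deriv[OF W] by (simp add: gradient_matrix_def)
  moreover have "(\<lambda>t. W_hat \<psi> \<alpha> (set_entry X k l t)) differentiable at ?x"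
    using W real_differentiable_def by blast
  ultimately show ?thesis
    by (simp add: B'_def mult.assoc)
qed

end
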